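(* Let $m\ge 1$, $N\ge 0$, and let $S(z)=\sum_{n=-N}^{N}C_nz^n$, $C_n\in\mathbb{C}^{m\times m}$, $C_N\neq 0$, be an $m\times m$ Laurent polynomial matrix function of degree $N$ such that $S(z)$ is positive definite for almost every $z\in\mathbb{T}$. Let $p$ be any scalar polynomial spectral factor of $\det S$, i.e. $p(z)=\sum_{n=0}^{L}p_nz^n$ with $p_n\in\mathbb{C}$, where $L$ is the degree of the Laurent polynomial $\det S$, and $$p(z)\,\widetilde{p}(z)=\det S(z),\qquad z\in\mathbb{C}\setminus\{0\}$$ (zeros of $p$ inside $\mathbb{T}$ are allowed). Then there exists a polynomial matrix function of the same degree $N$, $P(z)=\sum_{n=0}^{N}B_nz^n$, $B_n\in\mathbb{C}^{m\times m}$, such that $$P(z)\,\widetilde{P}(z)=S(z),\qquad z\in\mathbb{C}\setminus\{0\},$$ and $$\det P(z)=p(z),\qquad z\in\mathbb{C}.$$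
   Context: $\mathbb{T}=\{z\in\mathbb{C}:|z|=1\}$. For a (scalar or matrix) polynomial function $P(z)=\sum_{n=0}^{N}B_nz^n$, its adjoint is $\widetilde{P}(z)=\overline{P(1/\overline{z})}^{\,T}=\sum_{n=0}^{N}B_n^*z^{-n}$, where $B_n^*=\overline{B_n}^{\,T}$. A Laurent polynomial $\sum_{n=-L}^{L}c_nz^n$ has degree $L$ if $c_L\ne 0$ (here $\det S$ is a scalar Laurent polynomial that is nonnegative on $\mathbb{T}$, so its coefficients satisfy $c_{-n}=\overline{c_n}$); similarly for matrix coefficients. *)

theory Defs
  imports "HOL-Analysis.Analysis" "HOL-Computational_Algebra.Polynomial"
begin

definition mat_cscale :: "complex \<Rightarrow> complex^'n^'m \<Rightarrow> complex^'n^'m" where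
  "mat_cscale c A = (\<chi> i j. c * A $ i $ j)"

definition conj_transpose :: "complex^'n^'m \<Rightarrow> complex^'m^'n" where
  "conj_transpose A = (\<chi> i j. cnj (A $ j $ i))"

text \<open>For Hermitian matrices the quadratic form is real-valued, so taking its real part loses nothing.\<close>

definition positive_definite :: "complex^'m^'m \<Rightarrow> bool" where
  "positive_definite A \<longleftrightarrow>
     conj_transpose A = A \<and>
     (\<forall>v. v \<noteq> 0 \<longrightarrow> 0 < Re (\<Sum>i\<in>UNIV. cnj (v $ i) * (A *v v) $ i))"

definition poly_mat :: "nat \<Rightarrow> (nat \<Rightarrow> complex^'m^'m) \<Rightarrow> complex \<Rightarrow> complex^'m^'m" where
  "poly_mat N B z = (\<Sum>n=0..N. mat_cscale (z ^ n) (B n))"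

definition laurent_mat :: "nat \<Rightarrow> (int \<Rightarrow> complex^'m^'m) \<Rightarrow> complex \<Rightarrow> complex^'m^'m" where
  "laurent_mat N C z = (\<Sum>n=-int N..int N. mat_cscale (z powi n) (C n))"

text \<open>Laurent polynomials are considered as functions on the punctured plane, which determine
  their coefficients; hence the degree below is unique. Only the top coefficient is required to
  be nonzero; when \<open>f\<close> is real on the unit circle, the bottom one is its conjugate.\<close>

definition laurent_poly_of_degree :: "(complex \<Rightarrow> complex) \<Rightarrow> nat \<Rightarrow> bool" where
  "laurent_poly_of_degree f L \<longleftrightarrow>
     (\<exists>c :: int \<Rightarrow> complex. c (int L) \<noteq> 0 \<and>
        (\<forall>z. z \<noteq> 0 \<longrightarrow> f z = (\<Sum>n=-int L..int L. c n * z powi n)))"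

definition adj_fun :: "(complex \<Rightarrow> complex) \<Rightarrow> complex \<Rightarrow> complex" where
  "adj_fun p z = cnj (p (1 / cnj z))"

definition adj_mat_fun :: "(complex \<Rightarrow> complex^'m^'m) \<Rightarrow> complex \<Rightarrow> complex^'m^'m" where
  "adj_mat_fun P z = conj_transpose (P (1 / cnj z))"

end

theory Submission
  imports Defs "HOL-Computational_Algebra.Fundamental_Theorem_Algebra"
begin

text \<open>The Cayley transform \<open>z = (x - \<i>) / (x + \<i>)\<close> turns \<open>S\<close> into the polynomial matrix
  \<open>R(x) = (x\<^sup>2 + 1)\<^sup>N S(z)\<close>, which is Hermitian and positive semidefinite on the real line, and \<open>p\<close>
  into a polynomial \<open>q\<close> with \<open>det R = q q\<^sup>*\<close>. For such an \<open>R\<close> one finds \<open>R = Q Q\<^sup>*\<close> with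
  \<open>det Q = q\<close> by induction on the degree of \<open>q\<close>. At a root \<open>a\<close> of \<open>q\<close> some row vector annihilates
  \<open>R(a)\<close>; after a unimodular congruence a whole row of \<open>R\<close> vanishes at \<open>a\<close>, and \<open>x - a\<close> can be
  divided out of this row and \<open>x - cnj a\<close> out of the corresponding column. Choosing the roots of
  \<open>q\<close> (and not their conjugates) is what prescribes the determinant. When \<open>q\<close> is constant, the matrix of leading
  coefficients of \<open>R\<close> is singular unless \<open>R\<close> is constant, and a kernel vector gives a
  unimodular congruence lowering the degree of a diagonal entry; a constant \<open>R\<close> is diagonalized
  by the Gram--Schmidt process. Finally \<open>deg Q \<le> N\<close>, because
  the degrees of the \<open>\<bar>Q\<^sub>i\<^sub>j\<bar>\<^sup>2\<close> cannot cancel in \<open>R\<^sub>i\<^sub>i\<close>, so that \<open>Q\<close> transforms back to a polynomial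
  of degree at most \<open>N\<close> in \<open>z\<close>.\<close>

subsection \<open>Polynomial matrices and Hermitian forms\<close>

lemma poly_eq_on_infinite:
  fixes f g :: "'a::idom poly"
  assumes "infinite S" "\<And>x. x \<in> S \<Longrightarrow> poly f x = poly g x"
  shows "f = g"
proof (rule ccontr)
  assume "f \<noteq> g"
  then have "finite {x. poly (f - g) x = 0}" by (intro poly_roots_finite) simp
  moreover have "S \<subseteq> {x. poly (f - g) x = 0}" using assms(2) by auto
  ultimately show False using assms(1) finite_subset by blast
qed

lemma infinite_of_real: "infinite (range (of_real :: real \<Rightarrow> complex))"
  by (metis finite_imageD infinite_UNIV_char_0 inj_of_real)

lemma poly_eq_on_reals:
  fixes f g :: "complex poly"
  assumes "\<And>x. poly f (of_real x) = poly g (of_real x)"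
  shows "f = g"
  by (rule poly_eq_on_infinite[OF infinite_of_real]) (use assms in auto)

abbreviation cnj_poly :: "complex poly \<Rightarrow> complex poly" where
  "cnj_poly \<equiv> map_poly cnj"

lemma cnj_poly_mult [simp]: "cnj_poly (f * g) = cnj_poly f * cnj_poly g"
  by (simp add: poly_eq_poly_eq_iff[symmetric] fun_eq_iff)

lemma cnj_poly_sum [simp]: "cnj_poly (sum f A) = (\<Sum>x\<in>A. cnj_poly (f x))"
  by (simp add: poly_eq_poly_eq_iff[symmetric] fun_eq_iff poly_sum)

lemma cnj_poly_prod [simp]: "cnj_poly (prod f A) = (\<Prod>x\<in>A. cnj_poly (f x))"
  by (simp add: poly_eq_poly_eq_iff[symmetric] fun_eq_iff poly_prod)

lemma cnj_poly_of_int [simp]: "cnj_poly (of_int n) = of_int n"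
  by (simp add: poly_eq_poly_eq_iff[symmetric] fun_eq_iff)

lemma cnj_poly_cnj_poly [simp]: "cnj_poly (cnj_poly f) = f"
  by (simp add: poly_eq_poly_eq_iff[symmetric] fun_eq_iff)

lemma cnj_poly_eq_0_iff [simp]: "cnj_poly f = 0 \<longleftrightarrow> f = 0"
  by (simp add: map_poly_eq_0_iff)

lemma degree_cnj_poly [simp]: "degree (cnj_poly f) = degree f"
  by (simp add: degree_map_poly)

text \<open>On the real line, where \<open>cnj x = x\<close>, this evaluates to the conjugate
  transpose; unlike the adjoint on the circle it stays polynomial.\<close>

definition adj_poly_mat :: "complex poly^'n^'m \<Rightarrow> complex poly^'m^'n" where
  "adj_poly_mat A = (\<chi> i j. cnj_poly (A $ j $ i))"

definition eval_mat :: "complex poly^'n^'m \<Rightarrow> complex \<Rightarrow> complex^'n^'m" where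
  "eval_mat A x = (\<chi> i j. poly (A $ i $ j) x)"

lemma adj_poly_mat_nth [simp]: "adj_poly_mat A $ i $ j = cnj_poly (A $ j $ i)"
  by (simp add: adj_poly_mat_def)

lemma eval_mat_nth [simp]: "eval_mat A x $ i $ j = poly (A $ i $ j) x"
  by (simp add: eval_mat_def)

lemma conj_transpose_nth [simp]: "conj_transpose A $ i $ j = cnj (A $ j $ i)"
  by (simp add: conj_transpose_def)

lemma matrix_mult_nth: "(A ** B) $ i $ j = (\<Sum>k\<in>UNIV. A $ i $ k * B $ k $ j)"
  by (simp add: matrix_matrix_mult_def)

lemma adj_poly_mat_mult: "adj_poly_mat (A ** B) = adj_poly_mat B ** adj_poly_mat A"
  by (simp add: vec_eq_iff matrix_mult_nth mult.commute)

lemma adj_poly_mat_adj_poly_mat [simp]: "adj_poly_mat (adj_poly_mat A) = A"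
  by (simp add: vec_eq_iff)

lemma adj_poly_mat_1 [simp]: "adj_poly_mat (mat 1) = mat 1"
  by (simp add: vec_eq_iff mat_def poly_eq_poly_eq_iff[symmetric] fun_eq_iff)

lemma eval_mat_mult: "eval_mat (A ** B) x = eval_mat A x ** eval_mat B x"
  by (simp add: vec_eq_iff matrix_mult_nth poly_sum)

lemma eval_mat_adj: "eval_mat (adj_poly_mat A) x = conj_transpose (eval_mat A (cnj x))"
  by (simp add: vec_eq_iff)

lemma det_adj_poly_mat: "det (adj_poly_mat A) = cnj_poly (det A)"
proof -
  have "det (adj_poly_mat A) = det (transpose (adj_poly_mat A))" by simp
  also have "\<dots> = cnj_poly (det A)"
    by (simp add: det_def transpose_def)
  finally show ?thesis .
qed

lemma poly_det: "poly (det A) x = det (eval_mat A x)"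
  by (simp add: det_def poly_sum poly_prod)

lemma poly_mat_eq_on_reals:
  assumes "\<And>x. eval_mat A (of_real x) = eval_mat B (of_real x)"
  shows "A = B"
proof -
  have "A $ i $ j = B $ i $ j" for i j
    by (rule poly_eq_on_reals) (metis assms eval_mat_nth)
  then show ?thesis by (simp add: vec_eq_iff)
qed

section \<open>Hermitian forms and the Cauchy-Schwarz bound on entries\<close>

definition herm_form :: "complex^'n^'n \<Rightarrow> complex^'n \<Rightarrow> complex" where
  "herm_form A v = (\<Sum>i\<in>UNIV. cnj (v $ i) * (A *v v) $ i)"

lemma herm_form_eq: "herm_form A v = (\<Sum>i\<in>UNIV. \<Sum>j\<in>UNIV. cnj (v $ i) * A $ i $ j * v $ j)"
  by (simp add: herm_form_def matrix_vector_mult_def sum_distrib_left mult.assoc)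

lemma herm_form_congruence:
  "herm_form (G ** A ** conj_transpose G) v = herm_form A (conj_transpose G *v v)"
proof -
  have 1: "(\<Sum>i\<in>UNIV. cnj (v $ i) * (G *v u) $ i) = (\<Sum>i\<in>UNIV. cnj ((conj_transpose G *v v) $ i) * u $ i)" for u
    unfolding matrix_vector_mult_def
    by (simp add: sum_distrib_left sum_distrib_right mult_ac) (rule sum.swap)
  have "(G ** A ** conj_transpose G) *v v = G *v (A *v (conj_transpose G *v v))"
    by (simp add: matrix_vector_mul_assoc matrix_mul_assoc)
  then show ?thesis unfolding herm_form_def by (simp only: 1)
qed

lemma herm_form_diag:
  "herm_form A (axis i 1) = A $ i $ i"
  by (simp add: herm_form_def matrix_vector_mult_def axis_def if_distrib[of cnj] if_distrib[of "\<lambda>x. x * _"] if_distrib[of "\<lambda>x. _ * x"] cong: if_cong)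

text \<open>Testing the form on vectors supported on \<open>{i, j}\<close>, with
  \<open>- t * b\<close> at \<open>i\<close> and \<open>1\<close> at \<open>j\<close>, yields a real
  polynomial in \<open>t\<close> of degree at most two that is nowhere negative.\<close>

lemma psd_cauchy_schwarz:
  assumes herm: "conj_transpose A = A" and psd: "\<And>v. 0 \<le> Re (herm_form A v)"
  shows "(cmod (A $ i $ j))\<^sup>2 \<le> cmod (A $ i $ i) * cmod (A $ j $ j)"
proof (cases "i = j")
  case True
  then show ?thesis by (simp add: power2_eq_square)
next
  case False
  have h: "cnj (A $ k $ l) = A $ l $ k" for k l
    using herm by (metis conj_transpose_nth)
  have real: "A $ k $ k = of_real (Re (A $ k $ k))" for k
    using h[of k k] by (metis Reals_cnj_iff of_real_Re)
  have nonneg: "0 \<le> Re (A $ k $ k)" for k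
    using psd[of "axis k 1"] by (simp add: herm_form_diag)
  have norm: "cmod (A $ k $ k) = Re (A $ k $ k)" for k
    by (subst real) (use nonneg in auto)
  define a c b where "a = Re (A $ i $ i)" and "c = Re (A $ j $ j)" and "b = A $ i $ j"
  have q: "0 \<le> a * t\<^sup>2 * (cmod b)\<^sup>2 - 2 * t * (cmod b)\<^sup>2 + c" for t :: real
  proof -
    define u where "u = - of_real t * b"
    define v :: "complex^'a" where "v = (\<chi> k. if k = i then u else if k = j then 1 else 0)"
    have s: "(\<Sum>k\<in>UNIV. f k * v $ k) = f i * u + f j" for f
    proof -
      have "(\<Sum>k\<in>UNIV. f k * v $ k) = (\<Sum>k\<in>{i,j}. f k * v $ k)"
        by (rule sum.mono_neutral_right) (auto simp: v_def)
      then show ?thesis using False by (simp add: v_def)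
    qed
    have s2: "(\<Sum>k\<in>UNIV. cnj (v $ k) * f k) = cnj u * f i + f j" for f
    proof -
      have "(\<Sum>k\<in>UNIV. cnj (v $ k) * f k) = (\<Sum>k\<in>{i,j}. cnj (v $ k) * f k)"
        by (rule sum.mono_neutral_right) (auto simp: v_def)
      then show ?thesis using False by (simp add: v_def)
    qed
    have "herm_form A v = cnj u * (A $ i $ i * u + A $ i $ j) + (A $ j $ i * u + A $ j $ j)"
      unfolding herm_form_def matrix_vector_mult_def by (simp add: s s2)
    also have "\<dots> = cnj u * (of_real a * u + b) + (cnj b * u + of_real c)"
      using real[of i] real[of j] h[of i j] by (simp add: a_def c_def b_def)
    also have "\<dots> = of_real (a * t\<^sup>2) * (b * cnj b) - of_real (2 * t) * (b * cnj b) + of_real c"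
      unfolding u_def by (simp add: algebra_simps power2_eq_square)
    finally have "Re (herm_form A v) = a * t\<^sup>2 * (cmod b)\<^sup>2 - 2 * t * (cmod b)\<^sup>2 + c"
      unfolding complex_norm_square[symmetric] by (metis Re_complex_of_real of_real_add of_real_diff of_real_mult of_real_power)
    then show ?thesis using psd[of v] by simp
  qed
  have "(cmod b)\<^sup>2 \<le> a * c"
  proof (cases "a = 0")
    case True
    show ?thesis
    proof (cases "b = 0")
      case False
      \<comment> \<open>For \<open>a = 0\<close> the polynomial is affine in \<open>t\<close>, and
        this \<open>t\<close> gives it the value \<open>-1\<close>.\<close>
      define t where "t = (c + 1) / (2 * (cmod b)\<^sup>2)"
      have "2 * t * (cmod b)\<^sup>2 = c + 1" using False by (simp add: t_def)
      then show ?thesis using q[of t] True by simp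
    qed (use True in simp)
  next
    case False
    then have a: "0 < a" using nonneg[of i] a_def by simp
    \<comment> \<open>\<open>t = 1/a\<close> minimizes the quadratic polynomial.\<close>
    have "0 \<le> a * (1/a)\<^sup>2 * (cmod b)\<^sup>2 - 2 * (1/a) * (cmod b)\<^sup>2 + c" by (rule q)
    also have "\<dots> = c - (cmod b)\<^sup>2 / a"
      using a by (simp add: field_simps power2_eq_square)
    finally show ?thesis using a by (simp add: field_simps)
  qed
  then show ?thesis by (simp add: a_def b_def c_def norm)
qed

section \<open>Replacing one row by a combination of all rows\<close>

definition row_subst :: "'n \<Rightarrow> 'a::zero_neq_one^'n \<Rightarrow> 'a^'n^'n" where
  "row_subst i w = (\<chi> k. if k = i then w else axis k 1)"

lemma row_subst_mult_nth:
  fixes A :: "'a::comm_ring_1^'n^'n"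
  shows "(row_subst i w ** A) $ k $ l = (if k = i then (\<Sum>j\<in>UNIV. w $ j * A $ j $ l) else A $ k $ l)"
  by (simp add: matrix_mult_nth row_subst_def axis_def if_distrib[of "\<lambda>x. x * _"] cong: if_cong)

text \<open>Expand row \<open>i\<close> in unit vectors: for \<open>j \<noteq> i\<close> the vector
  \<open>axis j 1\<close> repeats row \<open>j\<close>, so only the term \<open>j = i\<close>
  survives.\<close>

lemma det_row_subst:
  fixes w :: "'a::comm_ring_1^'n"
  shows "det (row_subst i w) = w $ i"
proof -
  have w: "w = (\<Sum>j\<in>UNIV. w $ j *s axis j 1)"
    by (simp add: vec_eq_iff axis_def if_distrib[of "\<lambda>x. _ * x"] cong: if_cong)
  have "det (row_subst i w) = det (\<chi> k. if k = i then (\<Sum>j\<in>UNIV. w $ j *s axis j 1) else axis k 1)"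
    unfolding row_subst_def by (subst w) simp
  also have "\<dots> = (\<Sum>j\<in>UNIV. det (\<chi> k. if k = i then w $ j *s axis j 1 else axis k 1))"
    by (rule det_linear_row_sum) simp
  also have "\<dots> = (\<Sum>j\<in>UNIV. w $ j * det (\<chi> k. if k = i then axis j 1 else axis k 1))"
    by (simp add: det_row_mul)
  also have "\<dots> = (\<Sum>j\<in>UNIV. if j = i then w $ j else 0)"
  proof (rule sum.cong[OF refl])
    fix j
    show "w $ j * det (\<chi> k. if k = i then axis j 1 else axis k 1) = (if j = i then w $ j else 0)"
    proof (cases "j = i")
      case True
      have "(\<chi> k. if k = i then axis j 1 else axis k 1) = (mat 1 :: 'a^'n^'n)"
        using True by (auto simp: vec_eq_iff mat_def axis_def)
      then show ?thesis using True by simp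
    next
      case False
      then have "det (\<chi> k. if k = i then axis j 1 else axis k (1::'a)) = 0"
        by (intro det_identical_rows[of i j]) (auto simp: row_def)
      then show ?thesis using False by simp
    qed
  qed
  finally show ?thesis by simp
qed

text \<open>The inverse subtracts the added multiples again: \<open>2 *s axis i 1 - w\<close> has
  entry \<open>1\<close> at \<open>i\<close> and \<open>- w $ j\<close> elsewhere.\<close>

lemma row_subst_inverse:
  fixes w :: "'a::comm_ring_1^'n"
  assumes "w $ i = 1"
  shows "row_subst i (2 *s axis i 1 - w) ** row_subst i w = mat 1"
proof -
  have 1: "(\<Sum>j\<in>UNIV. (2 *s axis i 1 - w) $ j * row_subst i w $ j $ l) = (mat 1 :: 'a^'n^'n) $ i $ l" for l
  proof -
    have "(\<Sum>j\<in>UNIV. (2 *s axis i 1 - w) $ j * row_subst i w $ j $ l)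
      = (2 *s axis i 1 - w) $ i * row_subst i w $ i $ l + (\<Sum>j\<in>UNIV-{i}. (2 *s axis i 1 - w) $ j * row_subst i w $ j $ l)"
      by (rule sum.remove) auto
    also have "(\<Sum>j\<in>UNIV-{i}. (2 *s axis i 1 - w) $ j * row_subst i w $ j $ l) =
       (\<Sum>j\<in>UNIV-{i}. if l = j then - w $ j else 0)"
      by (rule sum.cong) (auto simp: row_subst_def axis_def)
    also have "\<dots> = (if l = i then 0 else - w $ l)" by auto
    finally show ?thesis using assms by (auto simp: row_subst_def mat_def axis_def)
  qed
  show ?thesis
    unfolding vec_eq_iff row_subst_mult_nth 1 by (auto simp: row_subst_def mat_def axis_def)
qed

subsection \<open>Nonnegativity on the real line\<close>

text \<open>Semidefiniteness is a closed condition, so it passes to limits;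
  \<open>det R \<noteq> 0\<close> makes the matrix definite at all but finitely many real
  points.\<close>

definition pos_on_line :: "complex poly^'n^'n \<Rightarrow> bool" where
  "pos_on_line R \<longleftrightarrow> adj_poly_mat R = R \<and> det R \<noteq> 0 \<and>
     (\<forall>x v. 0 \<le> Re (herm_form (eval_mat R (of_real x)) v))"

definition factorizes :: "complex poly^'n^'n \<Rightarrow> complex poly \<Rightarrow> bool" where
  "factorizes R q \<longleftrightarrow> (\<exists>Q. R = Q ** adj_poly_mat Q \<and> det Q = q)"

text \<open>Serves to make the form continuous in a real argument for fixed
  \<open>v\<close>.\<close>

lemma herm_form_eval_mat:
  "herm_form (eval_mat R x) v = poly (\<Sum>i\<in>UNIV. \<Sum>j\<in>UNIV. [:cnj (v $ i):] * R $ i $ j * [:v $ j:]) x"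
  by (simp add: herm_form_eq poly_sum mult_ac)

lemma pos_on_line_nth:
  assumes "pos_on_line R"
  shows "cnj_poly (R $ j $ i) = R $ i $ j"
  using assms unfolding pos_on_line_def by (metis adj_poly_mat_nth)

lemma pos_on_line_eval:
  assumes "pos_on_line R"
  shows "conj_transpose (eval_mat R (of_real x)) = eval_mat R (of_real x)"
    and "0 \<le> Re (herm_form (eval_mat R (of_real x)) v)"
proof -
  show "conj_transpose (eval_mat R (of_real x)) = eval_mat R (of_real x)"
    using assms eval_mat_adj[of R "of_real x"] by (simp add: pos_on_line_def)
qed (use assms in \<open>simp add: pos_on_line_def\<close>)

lemma pos_on_line_diag_nonneg:
  assumes "pos_on_line R"
  shows "0 \<le> Re (poly (R $ i $ i) (of_real x))"
  using pos_on_line_eval(2)[OF assms, of x "axis i 1"] by (simp add: herm_form_diag)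

lemma pos_on_line_congruence:
  assumes R: "pos_on_line R" and G: "det G \<noteq> 0"
  shows "pos_on_line (G ** R ** adj_poly_mat G)"
  unfolding pos_on_line_def
proof (intro conjI allI)
  have "adj_poly_mat R = R" using R by (simp add: pos_on_line_def)
  then show "adj_poly_mat (G ** R ** adj_poly_mat G) = G ** R ** adj_poly_mat G"
    by (simp add: adj_poly_mat_mult matrix_mul_assoc)
  show "det (G ** R ** adj_poly_mat G) \<noteq> 0"
    using R G by (simp add: det_mul det_adj_poly_mat pos_on_line_def)
  show "0 \<le> Re (herm_form (eval_mat (G ** R ** adj_poly_mat G) (of_real x)) v)" for x v
    using pos_on_line_eval(2)[OF R] by (simp add: eval_mat_mult eval_mat_adj herm_form_congruence)
qed

lemma pos_on_line_cauchy_schwarz: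
  assumes "pos_on_line R"
  shows "norm (poly (R $ i $ j * R $ i $ j) (of_real x)) \<le> norm (poly (R $ i $ i * R $ j $ j) (of_real x))"
  using psd_cauchy_schwarz[OF pos_on_line_eval[OF assms], of x i j]
  by (simp add: norm_mult power2_eq_square)

text \<open>By Cauchy-Schwarz a zero diagonal entry forces its whole row to vanish, hence the
  determinant too.\<close>

lemma pos_on_line_diag_nz:
  assumes "pos_on_line R"
  shows "R $ i $ i \<noteq> 0"
proof
  assume 0: "R $ i $ i = 0"
  have "R $ i $ j * R $ i $ j = 0" for j
    by (rule poly_eq_on_reals) (use pos_on_line_cauchy_schwarz[OF assms, of i j] 0 in auto)
  then have "row i R = 0" by (auto simp: row_def vec_eq_iff)
  then have "det R = 0" by (rule det_zero_row)
  then show False using assms by (simp add: pos_on_line_def)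
qed

section \<open>Degrees read off from growth along the real line\<close>

lemma poly_over_power_tendsto:
  fixes f :: "complex poly"
  assumes "degree f \<le> n"
  shows "((\<lambda>x::real. poly f (of_real x) / of_real x ^ n) \<longlongrightarrow> coeff f n) at_top"
proof -
  have "((\<lambda>x::real. \<Sum>k\<le>n. coeff f k * of_real ((1 / x) ^ (n - k))) \<longlongrightarrow> (\<Sum>k\<le>n. coeff f k * of_real (0 ^ (n - k)))) at_top"
    by (intro tendsto_intros tendsto_of_real tendsto_power) (rule tendsto_divide_0[OF tendsto_const filterlim_at_top_imp_at_infinity[OF filterlim_ident]])
  \<comment> \<open>Only \<open>k = n\<close> survives, because \<open>0 ^ 0 = 1\<close>; for
    \<open>n\<close> above the degree the limit is \<open>0\<close>.\<close>
  also have "(\<Sum>k\<le>n. coeff f k * of_real (0 ^ (n - k))) = (\<Sum>k\<le>n. if k = n then coeff f k else 0)"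
    by (intro sum.cong) auto
  also have "\<dots> = coeff f n" by simp
  finally show ?thesis
  proof (rule Lim_transform_eventually)
    show "\<forall>\<^sub>F x::real in at_top. (\<Sum>k\<le>n. coeff f k * of_real ((1 / x) ^ (n - k))) = poly f (of_real x) / of_real x ^ n"
      using eventually_gt_at_top[of 0]
    proof eventually_elim
      case (elim x)
      have "poly f (of_real x) = (\<Sum>k\<le>n. coeff f k * of_real x ^ k)"
        unfolding poly_altdef using assms
        by (intro sum.mono_neutral_left) (auto simp: coeff_eq_0)
      also have "\<dots> / of_real x ^ n = (\<Sum>k\<le>n. coeff f k * of_real ((1 / x) ^ (n - k)))"
        unfolding sum_divide_distrib
        by (intro sum.cong refl) (use elim in \<open>auto simp: field_simps power_add[symmetric]\<close>)
      finally show ?case by simp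
    qed
  qed
qed

text \<open>Divide both sides by \<open>x ^ degree f\<close>: if \<open>g\<close> had smaller
  degree, the right side would tend to \<open>0\<close> and the left to the norm of a nonzero
  leading coefficient.\<close>

lemma degree_le_if_norm_le:
  fixes f g :: "complex poly"
  assumes "\<And>x. norm (poly f (of_real x)) \<le> norm (poly g (of_real x))"
  shows "degree f \<le> degree g"
proof (rule ccontr)
  assume c: "\<not> degree f \<le> degree g"
  let ?n = "degree f"
  have f: "((\<lambda>x::real. norm (poly f (of_real x) / of_real x ^ ?n)) \<longlongrightarrow> norm (lead_coeff f)) at_top"
    by (intro tendsto_norm poly_over_power_tendsto) simp
  have g: "((\<lambda>x::real. norm (poly g (of_real x) / of_real x ^ ?n)) \<longlongrightarrow> norm (coeff g ?n)) at_top"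
    by (intro tendsto_norm poly_over_power_tendsto) (use c in simp)
  have "norm (lead_coeff f) \<le> norm (coeff g ?n)"
    by (rule tendsto_le[OF _ g f]) (auto simp: norm_divide intro!: always_eventually divide_right_mono assms)
  then have "f = 0" using c by (simp add: coeff_eq_0)
  then show False using c by simp
qed

lemma nonneg_imp_lead_coeff_nonneg:
  fixes f :: "complex poly"
  assumes "\<And>x. 0 \<le> Re (poly f (of_real x))"
  shows "0 \<le> Re (lead_coeff f)"
proof (rule tendsto_lowerbound)
  show "((\<lambda>x::real. Re (poly f (of_real x) / of_real x ^ degree f)) \<longlongrightarrow> Re (lead_coeff f)) at_top"
    by (intro tendsto_Re poly_over_power_tendsto) simp
  show "\<forall>\<^sub>F x::real in at_top. 0 \<le> Re (poly f (of_real x) / of_real x ^ degree f)"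
    using eventually_gt_at_top[of 0]
  proof eventually_elim
    case (elim x)
    then show ?case using assms[of x] by (simp flip: of_real_power)
  qed
qed simp

text \<open>The leading coefficients of \<open>f(x)\<close> and \<open>f(-x)\<close> differ by the
  factor \<open>(-1) ^ degree f\<close>, and neither may be negative.\<close>

lemma nonneg_imp_even_degree:
  fixes f :: "complex poly"
  assumes real: "cnj_poly f = f" and nonneg: "\<And>x. 0 \<le> Re (poly f (of_real x))"
  shows "even (degree f)"
proof (cases "f = 0")
  case False
  have "cnj (lead_coeff f) = lead_coeff f"
    using real by (metis coeff_map_poly complex_cnj_zero)
  then have im: "Im (lead_coeff f) = 0" by (simp add: complex_eq_iff)
  have "0 \<le> Re (lead_coeff (pcompose f [:0, -1:]))"
  proof (rule nonneg_imp_lead_coeff_nonneg)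
    show "0 \<le> Re (poly (pcompose f [:0, -1:]) (of_real x))" for x
      using nonneg[of "-x"] by (simp add: poly_pcompose)
  qed
  also have "lead_coeff (pcompose f [:0, -1:]) = lead_coeff f * (-1) ^ degree f"
    by (subst lead_coeff_comp) auto
  finally have "0 \<le> Re (lead_coeff f * (-1) ^ degree f)" .
  moreover have "Re (lead_coeff f) > 0"
    using nonneg_imp_lead_coeff_nonneg[of f, OF nonneg] im False
    by (metis complex_eq_iff leading_coeff_0_iff order_le_less zero_complex.sel)
  ultimately show ?thesis
    by (cases "even (degree f)") auto
qed simp

text \<open>Cauchy-Schwarz, read as a comparison of growth, bounds twice the degree of an entry by
  the two diagonal degrees; their evenness makes the halving exact.\<close>

lemma pos_on_line_degree:
  assumes "pos_on_line R"
  shows "even (degree (R $ i $ i))"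
    and "degree (R $ i $ j) \<le> degree (R $ i $ i) div 2 + degree (R $ j $ j) div 2"
proof -
  show e: "even (degree (R $ i $ i))" for i
    using pos_on_line_nth[OF assms] pos_on_line_diag_nonneg[OF assms] by (rule nonneg_imp_even_degree)
  have "degree (R $ i $ j * R $ i $ j) \<le> degree (R $ i $ i * R $ j $ j)"
    by (rule degree_le_if_norm_le, rule pos_on_line_cauchy_schwarz[OF assms])
  also have "\<dots> \<le> degree (R $ i $ i) + degree (R $ j $ j)" by (rule degree_mult_le)
  finally have "2 * degree (R $ i $ j) \<le> degree (R $ i $ i) + degree (R $ j $ j)"
    by (cases "R $ i $ j = 0") (auto simp: degree_mult_eq)
  then show "degree (R $ i $ j) \<le> degree (R $ i $ i) div 2 + degree (R $ j $ j) div 2"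
    using e[of i] e[of j] by (auto elim!: evenE)
qed

section \<open>Top coefficients of products and determinants\<close>

lemma coeff_mult_top:
  fixes f g :: "'a::comm_semiring_0 poly"
  assumes "degree f \<le> m" "degree g \<le> n"
  shows "coeff (f * g) (m + n) = coeff f m * coeff g n"
proof (cases "degree f = m \<and> degree g = n")
  case True
  then show ?thesis using coeff_mult_degree_sum by blast
next
  case False
  then have "degree f + degree g < m + n" using assms by linarith
  then have "coeff (f * g) (m + n) = 0"
    using degree_mult_le[of f g] by (intro coeff_eq_0) linarith
  moreover have "coeff f m = 0 \<or> coeff g n = 0"
    using False assms by (metis coeff_eq_0 order_le_less)
  ultimately show ?thesis by auto
qed

lemma degree_prod_le_sum:
  fixes f :: "'b \<Rightarrow> 'a::comm_semiring_1 poly"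
  assumes "finite A" "\<And>x. x \<in> A \<Longrightarrow> degree (f x) \<le> d x"
  shows "degree (prod f A) \<le> sum d A"
  using degree_prod_sum_le[OF assms(1), of f] sum_mono[of A "degree \<circ> f" d] assms(2) by simp

lemma coeff_prod_top:
  fixes f :: "'b \<Rightarrow> 'a::comm_semiring_1 poly"
  assumes "finite A" "\<And>x. x \<in> A \<Longrightarrow> degree (f x) \<le> d x"
  shows "coeff (prod f A) (sum d A) = (\<Prod>x\<in>A. coeff (f x) (d x))"
  using assms
proof (induction A rule: finite_induct)
  case (insert x F)
  then have "degree (prod f F) \<le> sum d F" by (intro degree_prod_le_sum) auto
  then show ?case using insert by (simp add: coeff_mult_top)
qed simp

lemma coeff_of_int_mult: "coeff (of_int k * f) n = of_int k * coeff f n"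
  by (simp add: of_int_poly coeff_mult_0 flip: smult_conv_map_poly)

text \<open>A permutation leaves \<open>sum d UNIV\<close> unchanged, so the degree bounds in every
  Leibniz term add up to the same number \<open>2 * sum d UNIV\<close>.\<close>

lemma coeff_det_top:
  fixes A :: "'a::comm_ring_1 poly^'n^'n"
  assumes "\<And>i j. degree (A $ i $ j) \<le> d i + d j"
  shows "coeff (det A) (2 * sum d UNIV) = det (\<chi> i j. coeff (A $ i $ j) (d i + d j))"
proof -
  have "coeff (\<Prod>i\<in>UNIV. A $ i $ p i) (2 * sum d UNIV) = (\<Prod>i\<in>UNIV. coeff (A $ i $ p i) (d i + d (p i)))"
    if p: "p permutes UNIV" for p
  proof -
    have "2 * sum d UNIV = (\<Sum>i\<in>UNIV. d i + d (p i))"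
      using sum.permute[OF p, of d] by (simp add: sum.distrib)
    then show ?thesis using assms by (simp add: coeff_prod_top)
  qed
  then show ?thesis by (simp add: det_def coeff_sum coeff_of_int_mult)
qed

lemma det_eq_0_left_kernel:
  fixes A :: "'a::field^'n^'n"
  assumes "det A = 0"
  obtains v where "v \<noteq> 0" "\<And>l. (\<Sum>j\<in>UNIV. v $ j * A $ j $ l) = 0"
proof -
  have "\<not> invertible (transpose A)" using assms by (simp add: invertible_det_nz)
  then obtain v where v: "v \<noteq> 0" "transpose A *v v = 0"
    using matrix_left_invertible_ker invertible_left_inverse by blast
  then have "(\<Sum>j\<in>UNIV. v $ j * A $ j $ l) = 0" for l
    by (simp add: vec_eq_iff matrix_vector_mult_def transpose_def mult.commute)
  with v(1) that show ?thesis by blast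
qed

subsection \<open>Unimodular congruence\<close>

lemma mult_adj_row_subst_nth:
  fixes A :: "complex poly^'n^'n"
  shows "(A ** adj_poly_mat (row_subst i w)) $ k $ l =
    (if l = i then (\<Sum>j\<in>UNIV. A $ k $ j * cnj_poly (w $ j)) else A $ k $ l)"
proof -
  have "adj_poly_mat (row_subst i w ** adj_poly_mat A) $ k $ l =
    (if l = i then (\<Sum>j\<in>UNIV. A $ k $ j * cnj_poly (w $ j)) else A $ k $ l)"
    unfolding adj_poly_mat_nth row_subst_mult_nth by (simp add: mult.commute)
  then show ?thesis by (simp add: adj_poly_mat_mult)
qed

text \<open>Acting on column \<open>i\<close> as well as row \<open>i\<close> keeps the matrix
  Hermitian and its form nonnegative.\<close>

definition row_congr :: "'n \<Rightarrow> complex poly^'n \<Rightarrow> complex poly^'n^'n \<Rightarrow> complex poly^'n^'n" where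
  "row_congr i w R = row_subst i w ** R ** adj_poly_mat (row_subst i w)"

lemma row_congr_nth:
  "k \<noteq> i \<Longrightarrow> l \<noteq> i \<Longrightarrow> row_congr i w R $ k $ l = R $ k $ l"
  "l \<noteq> i \<Longrightarrow> row_congr i w R $ i $ l = (\<Sum>j\<in>UNIV. w $ j * R $ j $ l)"
  "row_congr i w R $ i $ i = (\<Sum>l\<in>UNIV. (\<Sum>j\<in>UNIV. w $ j * R $ j $ l) * cnj_poly (w $ l))"
  by (auto simp: row_congr_def mult_adj_row_subst_nth row_subst_mult_nth)

lemma row_congr_pos:
  assumes "pos_on_line R" "w $ i = 1"
  shows "pos_on_line (row_congr i w R)"
  unfolding row_congr_def using assms by (intro pos_on_line_congruence) (auto simp: det_row_subst)

lemma det_row_congr: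
  assumes "w $ i = 1"
  shows "det (row_congr i w R) = det R"
  using assms by (simp add: row_congr_def det_mul det_adj_poly_mat det_row_subst)

text \<open>Undoing the congruence by the inverse \<open>H\<close> turns a factor \<open>Q\<close>
  into \<open>H ** Q\<close>; since \<open>det H = 1\<close>, the prescribed determinant is
  kept.\<close>

lemma factorizes_row_congr:
  assumes "factorizes (row_congr i w R) q" and w: "w $ i = 1"
  shows "factorizes R q"
proof -
  obtain Q where Q: "row_congr i w R = Q ** adj_poly_mat Q" "det Q = q"
    using assms by (auto simp: factorizes_def)
  define G H where "G = row_subst i w" and "H = row_subst i (2 *s axis i 1 - w)"
  have HG: "H ** G = mat 1" unfolding G_def H_def by (rule row_subst_inverse[OF w])
  have GH: "adj_poly_mat G ** adj_poly_mat H = mat 1"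
    by (simp add: HG flip: adj_poly_mat_mult)
  have "R = H ** G ** R ** (adj_poly_mat G ** adj_poly_mat H)" by (simp add: HG GH)
  also have "\<dots> = H ** row_congr i w R ** adj_poly_mat H"
    by (simp add: row_congr_def G_def matrix_mul_assoc)
  also have "\<dots> = (H ** Q) ** adj_poly_mat (H ** Q)"
    by (simp add: Q adj_poly_mat_mult matrix_mul_assoc)
  finally have "R = (H ** Q) ** adj_poly_mat (H ** Q)" .
  moreover have "det (H ** Q) = q"
    using Q(2) w by (simp add: det_mul H_def det_row_subst axis_def)
  ultimately show ?thesis unfolding factorizes_def by blast
qed

lemma poly_degree_0_eq: "degree f = 0 \<Longrightarrow> f = [:coeff f 0:]"
  by (auto elim: degree_eq_zeroE)

subsection \<open>Factorization on the real line\<close>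

text \<open>Square roots of the diagonal entries give a determinant of the right modulus; the
  missing phase is invisible in \<open>s k * cnj (s k)\<close>.\<close>

lemma factorizes_diagonal:
  fixes R :: "complex poly^'n^'n"
  assumes R: "pos_on_line R" and const: "\<And>k. degree (R $ k $ k) = 0"
    and diag: "\<And>k l. k \<noteq> l \<Longrightarrow> R $ k $ l = 0"
    and q: "det R = q * cnj_poly q" "degree q = 0"
  shows "factorizes R q"
proof -
  define r where "r k = Re (coeff (R $ k $ k) 0)" for k
  have Rk: "R $ k $ k = [:of_real (r k):]" for k
  proof -
    have "cnj (coeff (R $ k $ k) 0) = coeff (R $ k $ k) 0"
      using pos_on_line_nth[OF R, of k k] by (metis coeff_map_poly complex_cnj_zero)
    then have "of_real (r k) = coeff (R $ k $ k) 0"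
      by (simp add: r_def complex_eq_iff)
    then show ?thesis using poly_degree_0_eq[OF const[of k]] by metis
  qed
  have rpos: "0 < r k" for k
    using pos_on_line_diag_nonneg[OF R, of k 0] pos_on_line_diag_nz[OF R, of k]
    by (cases "r k = 0") (simp_all add: Rk)
  obtain c where c: "q = [:c:]" using q(2) by (auto elim: degree_eq_zeroE)
  have "poly (det R) 0 = of_real (\<Prod>k\<in>UNIV. r k)"
    by (subst det_diagonal) (simp_all add: diag poly_prod Rk)
  then have norm_c: "c * cnj c = of_real (\<Prod>k\<in>UNIV. r k)" using q(1) c by simp
  obtain i :: 'n where True by simp
  \<comment> \<open>One diagonal entry carries the phase, so that the determinant is exactly \<open>c\<close>.\<close>
  define s :: "'n \<Rightarrow> complex" where
    "s k = (if k = i then c / of_real (\<Prod>k\<in>UNIV-{i}. sqrt (r k)) else of_real (sqrt (r k)))" for k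
  define P where "P = (\<Prod>k\<in>UNIV-{i}. sqrt (r k))"
  have P: "P \<noteq> 0" using rpos unfolding P_def by (auto simp: less_imp_neq[symmetric])
  have P2: "P * P = (\<Prod>k\<in>UNIV-{i}. r k)"
    using rpos by (simp add: P_def less_imp_le flip: prod.distrib)
  have ri: "(\<Prod>k\<in>UNIV. r k) = r i * (P * P)"
    unfolding P2 by (rule prod.remove) auto
  have ss: "s k * cnj (s k) = of_real (r k)" for k
  proof (cases "k = i")
    case True
    then have "s k * cnj (s k) = c * cnj c / of_real (P * P)"
      by (simp add: s_def P_def)
    then show ?thesis using P True by (simp add: norm_c ri)
  qed (use rpos[of k] in \<open>simp add: s_def less_imp_le flip: of_real_mult\<close>)
  have "(\<Prod>k\<in>UNIV. s k) = s i * (\<Prod>k\<in>UNIV-{i}. s k)" by (rule prod.remove) auto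
  also have "(\<Prod>k\<in>UNIV-{i}. s k) = of_real P" by (simp add: s_def P_def)
  finally have prod_s: "(\<Prod>k\<in>UNIV. s k) = c" using P by (simp add: s_def P_def)
  define D :: "complex poly^'n^'n" where "D = (\<chi> k l. if k = l then [:s k:] else 0)"
  have "(D ** adj_poly_mat D) $ k $ l = R $ k $ l" for k l
  proof -
    have "(D ** adj_poly_mat D) $ k $ l = (\<Sum>j\<in>UNIV. if j = k then (if k = l then [:s k * cnj (s k):] else 0) else 0)"
      unfolding matrix_mult_nth by (intro sum.cong refl) (auto simp: D_def map_poly_pCons)
    then show ?thesis by (simp add: ss Rk diag)
  qed
  then have "R = D ** adj_poly_mat D" by (simp add: vec_eq_iff)
  moreover have "det D = q"
    by (subst det_diagonal) (auto simp: D_def prod_to_poly prod_s c)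
  ultimately show ?thesis unfolding factorizes_def by blast
qed

text \<open>Gram-Schmidt: \<open>T\<close> collects the indices among which \<open>R\<close> is
  already diagonal, and each round adds one more.\<close>

lemma factorizes_constant:
  fixes R :: "complex poly^'n^'n"
  assumes "pos_on_line R" "\<And>k. degree (R $ k $ k) = 0"
    and "det R = q * cnj_poly q" "degree q = 0"
    and "\<And>k l. k \<in> T \<Longrightarrow> l \<in> T \<Longrightarrow> k \<noteq> l \<Longrightarrow> R $ k $ l = 0"
  shows "factorizes R q"
  using assms
proof (induction "card (- T)" arbitrary: R T rule: less_induct)
  case less
  show ?case
  proof (cases "T = UNIV")
    case True
    then show ?thesis using less.prems by (intro factorizes_diagonal) auto
  next
    case False
    then obtain i where i: "i \<notin> T" by auto
    define A where "A j l = coeff (R $ j $ l) 0" for j l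
    \<comment> \<open>The diagonal degrees bound the others, so all entries are constant.\<close>
    have R: "R $ j $ l = [:A j l:]" for j l
      unfolding A_def using pos_on_line_degree(2)[OF less.prems(1), of j l]
      by (intro poly_degree_0_eq) (simp add: less.prems(2))
    have Anz: "A j j \<noteq> 0" for j
      using pos_on_line_diag_nz[OF less.prems(1), of j] by (simp add: R)
    \<comment> \<open>Row \<open>i\<close> is cleared against the rows in \<open>T\<close>, with the
      nonzero diagonal entries as pivots.\<close>
    define w :: "complex poly^'n" where
      "w = (\<chi> j. if j = i then 1 else if j \<in> T then [:- A i j / A j j:] else 0)"
    have wi: "w $ i = 1" by (simp add: w_def)
    let ?K = "row_congr i w R"
    have pos: "pos_on_line ?K" using less.prems(1) wi by (rule row_congr_pos)
    have row0: "?K $ i $ l = 0" if l: "l \<in> T" for l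
    proof -
      have li: "l \<noteq> i" using l i by auto
      have "?K $ i $ l = (\<Sum>j\<in>UNIV. w $ j * R $ j $ l)" using li by (rule row_congr_nth)
      also have "\<dots> = (\<Sum>j\<in>{i,l}. w $ j * R $ j $ l)"
        by (rule sum.mono_neutral_right) (use less.prems(5) l in \<open>auto simp: w_def\<close>)
      also have "\<dots> = 0" using li l by (simp add: w_def R Anz)
      finally show ?thesis .
    qed
    have col0: "?K $ l $ i = 0" if "l \<in> T" for l
      using row0[OF that] pos_on_line_nth[OF pos, of i l] by simp
    have deg_w: "degree (w $ j) = 0" for j by (simp add: w_def)
    have mult0: "degree (f * g) \<le> 0" if "degree f = 0" "degree g = 0" for f g :: "complex poly"
      using degree_mult_le[of f g] that by simp
    have "degree (\<Sum>j\<in>UNIV. w $ j * R $ j $ l) \<le> 0" for l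
      by (intro degree_sum_le mult0) (auto simp: deg_w R)
    then have "degree (?K $ i $ i) \<le> 0"
      unfolding row_congr_nth by (intro degree_sum_le mult0) (auto simp: deg_w)
    then have deg: "degree (?K $ k $ k) = 0" for k
      by (cases "k = i") (auto simp: row_congr_nth less.prems(2))
    have "card (- insert i T) < card (- T)"
      using i by (intro psubset_card_mono) auto
    then have "factorizes ?K q"
    proof (rule less.hyps[OF _ pos deg])
      show "det ?K = q * cnj_poly q" using less.prems(3) by (simp add: det_row_congr wi)
      show "degree q = 0" by fact
      show "?K $ k $ l = 0" if "k \<in> insert i T" "l \<in> insert i T" "k \<noteq> l" for k l
      proof (cases "k = i \<or> l = i")
        case True
        then show ?thesis using that row0[of l] col0[of k] by blast
      next
        case False
        then show ?thesis using that less.prems(5)[of k l] by (simp add: row_congr_nth)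
      qed
    qed
    then show ?thesis using wi by (rule factorizes_row_congr)
  qed
qed

text \<open>\<open>det H\<close> is the coefficient of \<open>det R\<close> at
  \<open>2 * sum d UNIV\<close>, a positive index, so it vanishes for constant \<open>det R\<close>.
  A left kernel vector of \<open>H\<close> then cancels the top of one diagonal entry.\<close>

lemma reduce_degree:
  fixes R :: "complex poly^'n^'n"
  assumes R: "pos_on_line R" and deg: "degree (R $ k $ k) \<noteq> 0" and det: "degree (det R) = 0"
  obtains i w where "w $ i = 1" "degree (row_congr i w R $ i $ i) < degree (R $ i $ i)"
proof -
  define d where "d i = degree (R $ i $ i) div 2" for i
  have d2: "degree (R $ i $ i) = 2 * d i" for i
    using pos_on_line_degree(1)[OF R, of i] by (simp add: d_def)
  have dle: "degree (R $ i $ j) \<le> d i + d j" for i j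
    unfolding d_def by (rule pos_on_line_degree(2)[OF R])
  define H :: "complex^'n^'n" where "H = (\<chi> i j. coeff (R $ i $ j) (d i + d j))"
  have "0 < d k" using deg d2[of k] by simp
  also have "d k \<le> sum d UNIV" by (rule member_le_sum) auto
  finally have "coeff (det R) (2 * sum d UNIV) = 0" using det by (intro coeff_eq_0) simp
  then have "det H = 0" unfolding H_def by (simp add: coeff_det_top dle)
  then obtain v where v: "v \<noteq> 0" "\<And>l. (\<Sum>j\<in>UNIV. v $ j * H $ j $ l) = 0"
    using det_eq_0_left_kernel by metis
  let ?S = "{j. v $ j \<noteq> 0}"
  have "?S \<noteq> {}" using v(1) by (auto simp: vec_eq_iff)
  \<comment> \<open>Maximality of \<open>d i\<close> on the support of \<open>v\<close> makes the
    exponents \<open>d i - d j\<close> honest differences.\<close>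
  then have "Max (d ` ?S) \<in> d ` ?S" by (intro Max_in) auto
  then obtain i where vi: "v $ i \<noteq> 0" and di: "d i = Max (d ` ?S)" by auto
  have max: "d j \<le> d i" if "v $ j \<noteq> 0" for j
    unfolding di using that by (intro Max_ge) auto
  \<comment> \<open>The subtraction truncates only where \<open>v $ j = 0\<close>, and there the monomial vanishes.\<close>
  define w :: "complex poly^'n" where "w = (\<chi> j. monom (v $ j / v $ i) (d i - d j))"
  have wi: "w $ i = 1" by (simp add: w_def vi)
  let ?K = "row_congr i w R"
  have terms: "degree (w $ j * R $ j $ l * cnj_poly (w $ l)) \<le> 2 * d i \<and>
     coeff (w $ j * R $ j $ l * cnj_poly (w $ l)) (2 * d i) = v $ j / v $ i * H $ j $ l * cnj (v $ l / v $ i)" for j l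
  proof (cases "v $ j = 0 \<or> v $ l = 0")
    case False
    \<comment> \<open>The bounds \<open>?a\<close>, \<open>?b\<close>, \<open>?c\<close> sum to
      \<open>2 * d i\<close> for every \<open>j\<close> and \<open>l\<close>, so all top terms meet
      in one coefficient.\<close>
    let ?a = "d i - d j" and ?b = "d j + d l" and ?c = "d i - d l"
    have e: "2 * d i = ?a + ?b + ?c" using False max[of j] max[of l] by simp
    have a: "degree (w $ j) \<le> ?a" "degree (cnj_poly (w $ l)) \<le> ?c"
      by (simp_all add: w_def degree_monom_le)
    then have ab: "degree (w $ j * R $ j $ l) \<le> ?a + ?b"
      using degree_mult_le[of "w $ j" "R $ j $ l"] dle[of j l] by linarith
    have "coeff (w $ j * R $ j $ l * cnj_poly (w $ l)) (2 * d i) =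
       coeff (w $ j) ?a * coeff (R $ j $ l) ?b * coeff (cnj_poly (w $ l)) ?c"
      unfolding e using a ab dle[of j l] by (simp add: coeff_mult_top)
    moreover have "degree (w $ j * R $ j $ l * cnj_poly (w $ l)) \<le> 2 * d i"
      unfolding e using degree_mult_le[of "w $ j * R $ j $ l" "cnj_poly (w $ l)"] a ab by linarith
    ultimately show ?thesis by (simp add: w_def H_def coeff_map_poly)
  qed (auto simp: w_def)
  have K: "?K $ i $ i = (\<Sum>l\<in>UNIV. \<Sum>j\<in>UNIV. w $ j * R $ j $ l * cnj_poly (w $ l))"
    by (simp add: row_congr_nth sum_distrib_right)
  have "degree (?K $ i $ i) \<le> 2 * d i"
    unfolding K by (intro degree_sum_le) (auto simp: terms)
  moreover have "coeff (?K $ i $ i) (2 * d i) = 0"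
  proof -
    have "coeff (?K $ i $ i) (2 * d i) =
      (\<Sum>l\<in>UNIV. (\<Sum>j\<in>UNIV. v $ j * H $ j $ l) * (cnj (v $ l / v $ i) / v $ i))"
      unfolding K coeff_sum sum_distrib_right terms[THEN conjunct2] by (simp add: mult.commute)
    then show ?thesis by (simp add: v(2))
  qed
  \<comment> \<open>Being nonzero turns the vanishing coefficient into a strict drop of degree; it
    also rules out \<open>d i = 0\<close>.\<close>
  moreover have "?K $ i $ i \<noteq> 0"
    using R wi by (intro pos_on_line_diag_nz row_congr_pos)
  ultimately have "degree (?K $ i $ i) < 2 * d i"
    by (metis leading_coeff_0_iff order_le_less)
  then show ?thesis using that wi d2 by metis
qed

text \<open>Only the diagonal entry \<open>i\<close> changes in a reduction, so the sum of the
  diagonal degrees drops until the constant case is reached.\<close>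

lemma factorizes_unimodular:
  fixes R :: "complex poly^'n^'n"
  assumes "pos_on_line R" "det R = q * cnj_poly q" "degree q = 0"
  shows "factorizes R q"
  using assms
proof (induction "\<Sum>k\<in>UNIV. degree (R $ k $ k)" arbitrary: R rule: less_induct)
  case less
  show ?case
  proof (cases "\<forall>k. degree (R $ k $ k) = 0")
    case True
    then show ?thesis using less.prems by (intro factorizes_constant[where T = "{}"]) auto
  next
    case False
    then obtain k where k: "degree (R $ k $ k) \<noteq> 0" by auto
    have "degree (det R) = 0"
      using degree_mult_le[of q "cnj_poly q"] less.prems by simp
    then obtain i w where w: "w $ i = 1" "degree (row_congr i w R $ i $ i) < degree (R $ i $ i)"
      using reduce_degree[OF less.prems(1) k] by metis
    have "(\<Sum>k\<in>UNIV. degree (row_congr i w R $ k $ k)) < (\<Sum>k\<in>UNIV. degree (R $ k $ k))"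
    proof (rule sum_strict_mono_ex1)
      show "\<forall>x\<in>UNIV. degree (row_congr i w R $ x $ x) \<le> degree (R $ x $ x)"
        using w(2) by (metis order_le_less row_congr_nth(1))
    qed (use w in auto)
    then have "factorizes (row_congr i w R) q"
      by (rule less.hyps) (use less.prems w in \<open>auto simp: det_row_congr row_congr_pos\<close>)
    then show ?thesis using w(1) by (rule factorizes_row_congr)
  qed
qed

section \<open>Splitting off a root of the determinant\<close>

lemma isCont_Re_poly_of_real: "isCont (\<lambda>x::real. Re (poly f (of_real x))) b"
  by (intro continuous_Re isCont_o2[OF _ poly_isCont]) (simp add: continuous_of_real)

text \<open>A non-real root comes with its conjugate. At a real root \<open>b\<close> the cofactor
  \<open>h\<close> is real, nonpositive to the left and nonnegative to the right, so it vanishes at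
  \<open>b\<close> by continuity.\<close>

lemma nonneg_double_root:
  fixes f :: "complex poly"
  assumes real: "cnj_poly f = f" and nonneg: "\<And>x. 0 \<le> Re (poly f (of_real x))"
    and root: "poly f a = 0"
  shows "[:- a, 1:] * [:- cnj a, 1:] dvd f"
proof -
  obtain h where h: "f = [:- a, 1:] * h" using root by (metis poly_eq_0_iff_dvd dvdE)
  have "poly h (cnj a) = 0"
  proof (cases "cnj a = a")
    case False
    have "poly f (cnj a) = 0"
      using root real by (metis complex_cnj_zero poly_cnj)
    then show ?thesis using False by (simp add: h)
  next
    case True
    then obtain b where b: "a = of_real b" by (metis Reals_cnj_iff Reals_cases)
    have "[:- a, 1:] * cnj_poly h = [:- a, 1:] * h"
      using real True unfolding h cnj_poly_mult by (simp add: map_poly_pCons)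
    then have "cnj_poly h = h" by (metis mult_cancel_left pCons_eq_0_iff one_neq_zero)
    then have "cnj (poly h a) = poly h a" using True by (metis poly_cnj)
    then have im: "Im (poly h a) = 0" by (simp add: complex_eq_iff)
    have f: "0 \<le> (x - b) * Re (poly h (of_real x))" for x
      using nonneg[of x] by (simp add: h b) (simp add: algebra_simps)
    have pos: "0 \<le> Re (poly h (of_real x))" if "b < x" for x
      using f[of x] that by (simp add: zero_le_mult_iff)
    have neg: "Re (poly h (of_real x)) \<le> 0" if "x < b" for x
      using f[of x] that by (simp add: zero_le_mult_iff)
    have cont: "isCont (\<lambda>x::real. Re (poly h (of_real x))) b"
      by (rule isCont_Re_poly_of_real)
    have "0 \<le> Re (poly h (of_real b))"
    proof (rule tendsto_lowerbound)
      show "((\<lambda>x::real. Re (poly h (of_real x))) \<longlongrightarrow> Re (poly h (of_real b))) (at_right b)"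
        using cont unfolding isCont_def by (rule tendsto_within_subset) auto
      show "\<forall>\<^sub>F x in at_right b. 0 \<le> Re (poly h (of_real x))"
        using pos by (auto simp: eventually_at_filter)
    qed simp
    moreover have "Re (poly h (of_real b)) \<le> 0"
    proof (rule tendsto_upperbound)
      show "((\<lambda>x::real. Re (poly h (of_real x))) \<longlongrightarrow> Re (poly h (of_real b))) (at_left b)"
        using cont unfolding isCont_def by (rule tendsto_within_subset) auto
      show "\<forall>\<^sub>F x in at_left b. Re (poly h (of_real x)) \<le> 0"
        using neg by (auto simp: eventually_at_filter)
    qed simp
    ultimately show ?thesis using im unfolding b by (simp add: complex_eq_iff)
  qed
  then have "[:- cnj a, 1:] dvd h" by (simp add: poly_eq_0_iff_dvd)
  then show ?thesis unfolding h by (rule mult_dvd_mono[OF dvd_refl])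
qed

text \<open>Away from \<open>a\<close> the matrix \<open>D\<close> is invertible, so the form of
  \<open>K'\<close> is that of \<open>K\<close> at another vector; at \<open>a\<close> itself
  continuity takes over.\<close>

lemma pos_on_line_divide:
  fixes K :: "complex poly^'n^'n"
  assumes D: "K = D ** K' ** adj_poly_mat D" and K: "pos_on_line K"
    and diag: "D = (\<chi> k l. if k = l then d k else 0)"
    and d: "\<And>k x. x \<noteq> a \<Longrightarrow> poly (d k) x \<noteq> 0"
  shows "pos_on_line K'"
proof -
  have D_nth: "(D ** A ** adj_poly_mat D) $ k $ l = d k * A $ k $ l * cnj_poly (d l)" for A k l
    unfolding matrix_mult_nth diag
    by (simp add: if_distrib[of "\<lambda>x. x * _"] if_distrib[of "\<lambda>x. _ * x"] if_distrib[of cnj_poly] cong: if_cong)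
  have dnz: "d k \<noteq> 0" for k using d[of "a + 1" k] by auto
  have "det K' \<noteq> 0" using K unfolding D pos_on_line_def by (auto simp: det_mul)
  moreover have "adj_poly_mat K' = K'"
  proof -
    have "D ** adj_poly_mat K' ** adj_poly_mat D = D ** K' ** adj_poly_mat D"
      using K unfolding D pos_on_line_def by (simp add: adj_poly_mat_mult matrix_mul_assoc)
    then have "d k * adj_poly_mat K' $ k $ l * cnj_poly (d l) = d k * K' $ k $ l * cnj_poly (d l)" for k l
      by (metis D_nth)
    then show ?thesis using dnz unfolding vec_eq_iff by simp
  qed
  moreover have off: "0 \<le> Re (herm_form (eval_mat K' (of_real x)) v)" if x: "of_real x \<noteq> a" for x v
  proof -
    \<comment> \<open>The solution of
      \<open>conj_transpose (eval_mat D (of_real x)) *v u = v\<close>.\<close>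
    define u where "u = (\<chi> k. v $ k / cnj (poly (d k) (of_real x)))"
    have "conj_transpose (eval_mat D (of_real x)) *v u = v"
      using d[OF x] by (simp add: vec_eq_iff matrix_vector_mult_def u_def diag if_distrib[of "\<lambda>f. poly f _"] 
          if_distrib[of cnj] if_distrib[of "\<lambda>x. x * _"] if_distrib[of "\<lambda>x. x / _"] cong: if_cong)
    then have "herm_form (eval_mat K' (of_real x)) v = herm_form (eval_mat K (of_real x)) u"
      unfolding D by (simp add: eval_mat_mult eval_mat_adj herm_form_congruence)
    then show ?thesis using pos_on_line_eval(2)[OF K] by simp
  qed
  moreover have "0 \<le> Re (herm_form (eval_mat K' (of_real x)) v)" for x v
  proof (rule tendsto_lowerbound)
    have "isCont (\<lambda>x. Re (herm_form (eval_mat K' (of_real x)) v)) x"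
      unfolding herm_form_eval_mat by (rule isCont_Re_poly_of_real)
    then show "((\<lambda>x. Re (herm_form (eval_mat K' (of_real x)) v)) \<longlongrightarrow> Re (herm_form (eval_mat K' (of_real x)) v)) (at x)"
      by (simp add: isCont_def)
    \<comment> \<open>Avoiding \<open>Re a\<close> avoids \<open>a\<close>, whether or not
      \<open>a\<close> is real.\<close>
    have "\<forall>\<^sub>F y in at x. y \<noteq> Re a"
      by (cases "x = Re a") (auto simp: eventually_at_filter intro!: t1_space_nhds eventually_mono[OF t1_space_nhds[of x "Re a"]])
    then show "\<forall>\<^sub>F y in at x. 0 \<le> Re (herm_form (eval_mat K' (of_real y)) v)"
      by eventually_elim (rule off, auto)
  qed simp
  ultimately show ?thesis by (simp add: pos_on_line_def)
qed

text \<open>A left kernel vector of \<open>R\<close> at \<open>a\<close>, scaled to \<open>1\<close>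
  at some index \<open>i\<close>, serves as a constant \<open>w\<close>; after the congruence row
  \<open>i\<close> vanishes at \<open>a\<close>.\<close>

lemma extract_root:
  fixes R :: "complex poly^'n^'n"
  assumes R: "pos_on_line R" and a: "poly (det R) a = 0"
  obtains i w D K' where "w $ i = 1" "row_congr i w R = D ** K' ** adj_poly_mat D"
    "pos_on_line K'" "det D = [:- a, 1:]"
proof -
  have "det (eval_mat R a) = 0" using a by (simp add: poly_det)
  then obtain v where v: "v \<noteq> 0" "\<And>l. (\<Sum>j\<in>UNIV. v $ j * eval_mat R a $ j $ l) = 0"
    using det_eq_0_left_kernel by metis
  obtain i where vi: "v $ i \<noteq> 0" using v(1) by (auto simp: vec_eq_iff)
  define w :: "complex poly^'n" where "w = (\<chi> j. [:v $ j / v $ i:])"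
  have wi: "w $ i = 1" using vi by (simp add: w_def)
  let ?K = "row_congr i w R"
  have K: "pos_on_line ?K" using R wi by (rule row_congr_pos)
  have wR: "poly (\<Sum>j\<in>UNIV. w $ j * R $ j $ l) a = 0" for l
  proof -
    have "poly (\<Sum>j\<in>UNIV. w $ j * R $ j $ l) a = (\<Sum>j\<in>UNIV. v $ j * eval_mat R a $ j $ l) / v $ i"
      by (simp add: poly_sum w_def sum_divide_distrib)
    then show ?thesis by (simp only: v(2)) simp
  qed
  have row: "poly (?K $ i $ l) a = 0" for l
  proof (cases "l = i")
    case True
    then show ?thesis using wR by (simp add: row_congr_nth poly_sum)
  next
    case False
    then show ?thesis using wR by (simp add: row_congr_nth)
  qed
  have rowd: "[:- a, 1:] dvd ?K $ i $ l" for l using row by (simp add: poly_eq_0_iff_dvd)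
  define d where "d k = (if k = i then [:- a, 1:] else 1)" for k
  \<comment> \<open>The corner entry needs both factors, which the double root supplies; column
    \<open>i\<close> is the adjoint of row \<open>i\<close>.\<close>
  have "d k * cnj_poly (d l) dvd ?K $ k $ l" for k l
  proof (cases "k = i"; cases "l = i")
    assume "k = i" "l = i"
    then show ?thesis
      using nonneg_double_root[OF pos_on_line_nth[OF K, of i i] pos_on_line_diag_nonneg[OF K] row]
      by (simp add: d_def map_poly_pCons del: mult_pCons_left mult_pCons_right)
  next
    assume "k \<noteq> i" "l = i"
    moreover obtain h where "?K $ l $ k = d i * h" using rowd[of k] \<open>l = i\<close> by (auto simp: d_def elim!: dvdE)
    then have "?K $ k $ l = cnj_poly (d i) * cnj_poly h"
      using pos_on_line_nth[OF K, of l k] by (metis cnj_poly_mult)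
    ultimately show ?thesis by (simp add: d_def)
  qed (use rowd in \<open>auto simp: d_def\<close>)
  then have "\<forall>k l. \<exists>h. ?K $ k $ l = d k * cnj_poly (d l) * h" by (auto elim!: dvdE)
  then obtain h where h: "\<And>k l. ?K $ k $ l = d k * cnj_poly (d l) * h k l" by metis
  define K' where "K' = (\<chi> k l. h k l)"
  define D :: "complex poly^'n^'n" where "D = (\<chi> k l. if k = l then d k else 0)"
  have "(D ** K' ** adj_poly_mat D) $ k $ l = ?K $ k $ l" for k l
    unfolding matrix_mult_nth D_def h
    by (simp add: K'_def mult_ac if_distrib[of "\<lambda>x. x * _"] if_distrib[of "\<lambda>x. _ * x"] if_distrib[of cnj_poly] cong: if_cong)
  then have DK: "?K = D ** K' ** adj_poly_mat D" by (simp add: vec_eq_iff)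
  have "det D = (\<Prod>k\<in>UNIV. d k)"
    by (subst det_diagonal) (auto simp: D_def)
  then have "det D = [:- a, 1:]" by (simp add: d_def)
  moreover have "pos_on_line K'"
    by (rule pos_on_line_divide[OF DK K D_def, of a]) (simp add: d_def)
  ultimately show ?thesis using that wi DK by blast
qed

text \<open>Each step takes a root \<open>a\<close> of \<open>q\<close> itself, so that
  \<open>x - a\<close> goes into \<open>det D\<close> and its conjugate into the adjoint
  factor.\<close>

theorem factorizes_pos_on_line:
  fixes R :: "complex poly^'n^'n"
  assumes "pos_on_line R" "det R = q * cnj_poly q"
  shows "factorizes R q"
  using assms
proof (induction "degree q" arbitrary: R q)
  case 0
  then show ?case by (intro factorizes_unimodular) auto
next
  case (Suc n)
  have "\<not> constant (poly q)" using Suc.hyps(2) by (simp add: constant_degree)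
  then obtain a where a: "poly q a = 0" using fundamental_theorem_of_algebra by blast
  then obtain q' where q': "q = [:- a, 1:] * q'" by (metis poly_eq_0_iff_dvd dvdE)
  have "poly (det R) a = 0" using a Suc.prems(2) by simp
  then obtain i w D K' where w: "w $ i = 1" and K: "row_congr i w R = D ** K' ** adj_poly_mat D"
    and pos: "pos_on_line K'" and D: "det D = [:- a, 1:]"
    using extract_root[OF Suc.prems(1)] by metis
  have "q' \<noteq> 0" using q' Suc.hyps(2) by auto
  then have deg: "n = degree q'" using Suc.hyps(2) unfolding q' by (subst (asm) degree_mult_eq) auto
  \<comment> \<open>Cancelling the nonzero factor \<open>det D * cnj_poly (det D)\<close> leaves the
    hypothesis for \<open>K'\<close> and \<open>q'\<close>.\<close>
  have "det D * cnj_poly (det D) * det K' = det D * cnj_poly (det D) * (q' * cnj_poly q')"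
    using det_row_congr[OF w, of R] unfolding K Suc.prems(2) q' D
    by (simp only: det_mul det_adj_poly_mat D cnj_poly_mult mult_ac)
  moreover have "det D \<noteq> 0" by (simp add: D)
  then have "det D * cnj_poly (det D) \<noteq> 0" by simp
  ultimately have "det K' = q' * cnj_poly q'" by (metis mult_cancel_left)
  then obtain Q where Q: "K' = Q ** adj_poly_mat Q" "det Q = q'"
    using Suc.hyps(1)[OF deg pos] by (auto simp: factorizes_def)
  have "row_congr i w R = (D ** Q) ** adj_poly_mat (D ** Q)"
    unfolding K Q(1) by (simp add: adj_poly_mat_mult matrix_mul_assoc)
  moreover have "det (D ** Q) = q" by (simp only: det_mul D Q(2) q')
  ultimately have "factorizes (row_congr i w R) q" unfolding factorizes_def by blast
  then show ?case using w by (rule factorizes_row_congr)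
qed

subsection \<open>Transfer to the unit circle\<close>

text \<open>The binary form of degree \<open>n\<close> attached to \<open>f\<close>, taken at
  \<open>(u, v)\<close>: for \<open>degree f \<le> n\<close> it is \<open>f(u / v)\<close> with
  denominators cleared by \<open>v ^ n\<close>.\<close>

definition poly_homogenize :: "nat \<Rightarrow> 'a::comm_ring_1 poly \<Rightarrow> 'a poly \<Rightarrow> 'a poly \<Rightarrow> 'a poly" where
  "poly_homogenize n u v f = (\<Sum>k\<le>n. smult (coeff f k) (u ^ k * v ^ (n - k)))"

lemma poly_poly_homogenize:
  fixes f :: "'a::field poly"
  assumes "degree f \<le> n" "poly v x \<noteq> 0"
  shows "poly (poly_homogenize n u v f) x = poly v x ^ n * poly f (poly u x / poly v x)"
proof -
  have "poly f y = (\<Sum>k\<le>n. coeff f k * y ^ k)" for y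
    unfolding poly_altdef using assms(1) by (intro sum.mono_neutral_left) (auto simp: coeff_eq_0)
  then show ?thesis
    using assms(2)
    by (auto simp: poly_homogenize_def poly_sum sum_distrib_left power_divide power_diff intro!: sum.cong)
qed

lemma degree_poly_homogenize:
  assumes "degree u \<le> 1" "degree v \<le> 1"
  shows "degree (poly_homogenize n u v f) \<le> n"
  unfolding poly_homogenize_def
proof (intro degree_sum_le)
  fix k assume k: "k \<in> {..n}"
  have "degree (u ^ k) \<le> k"
    using degree_power_le[of u k] assms(1) mult_le_mono1[of "degree u" 1 k] by linarith
  moreover have "degree (v ^ (n - k)) \<le> n - k"
    using degree_power_le[of v "n - k"] assms(2) mult_le_mono1[of "degree v" 1 "n - k"] by linarith
  ultimately have "degree (u ^ k * v ^ (n - k)) \<le> n"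
    using degree_mult_le[of "u ^ k" "v ^ (n - k)"] k by simp
  then show "degree (smult (coeff f k) (u ^ k * v ^ (n - k))) \<le> n"
    using degree_smult_le order.trans by blast
qed simp

text \<open>The Laurent polynomial with coefficients \<open>c\<close>, multiplied by
  \<open>z ^ n\<close>.\<close>

definition laurent_poly :: "nat \<Rightarrow> (int \<Rightarrow> 'a::comm_ring_1) \<Rightarrow> 'a poly" where
  "laurent_poly n c = (\<Sum>k\<le>2 * n. monom (c (int k - int n)) k)"

lemma coeff_laurent_poly: "coeff (laurent_poly n c) k = (if k \<le> 2 * n then c (int k - int n) else 0)"
  by (simp add: laurent_poly_def coeff_sum)

lemma degree_laurent_poly: "degree (laurent_poly n c) \<le> 2 * n"
  by (rule degree_le) (simp add: coeff_laurent_poly)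

lemma poly_laurent_poly:
  fixes z :: complex
  assumes "z \<noteq> 0"
  shows "poly (laurent_poly n c) z = z ^ n * (\<Sum>k=-int n..int n. c k * z powi k)"
proof -
  have "(\<Sum>k=-int n..int n. c k * z powi k) = (\<Sum>k\<le>2 * n. c (int k - int n) * z powi (int k - int n))"
    by (rule sum.reindex_bij_witness[of _ "\<lambda>k. int k - int n" "\<lambda>k. nat (k + int n)"]) auto
  moreover have "z ^ n * (a * z powi (int k - int n)) = a * z ^ k" for a k
    using assms by (simp add: power_int_diff)
  ultimately show ?thesis
    unfolding laurent_poly_def poly_sum poly_monom by (simp only: sum_distrib_left)
qed

lemma laurent_mat_nth: "laurent_mat N C z $ i $ j = (\<Sum>n=-int N..int N. C n $ i $ j * z powi n)"
  by (simp add: laurent_mat_def mat_cscale_def mult.commute)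

lemma poly_mat_nth: "poly_mat N B z $ i $ j = (\<Sum>n=0..N. B n $ i $ j * z ^ n)"
  by (simp add: poly_mat_def mat_cscale_def mult.commute)

lemma mat_cscale_nth [simp]: "mat_cscale c A $ i $ j = c * A $ i $ j"
  by (simp add: mat_cscale_def)

lemma det_mat_cscale: "det (mat_cscale c A) = c ^ CARD('n) * det (A :: complex^'n^'n)"
proof -
  have "mat_cscale c A = (\<chi> i. c *s A $ i)" by (simp add: vec_eq_iff)
  then show ?thesis using det_rows_mul[of "\<lambda>_. c" "\<lambda>i. A $ i"] by simp
qed

lemma herm_form_mat_cscale: "herm_form (mat_cscale c A) v = c * herm_form A v"
  by (simp add: herm_form_eq sum_distrib_left mult_ac)

section \<open>The Cayley transform\<close>

definition cayley :: "real \<Rightarrow> complex" where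
  "cayley x = (of_real x - \<i>) / (of_real x + \<i>)"

lemma of_real_plus_i_nz [simp]: "of_real x + \<i> \<noteq> 0" "\<i> + of_real x \<noteq> 0" "of_real x \<noteq> \<i>"
  by (auto simp: complex_eq_iff)

lemma plus_i_times_minus_i: "(of_real x + \<i>) * (of_real x - \<i>) = of_real (x\<^sup>2 + 1)"
  by (simp add: complex_eq_iff power2_eq_square algebra_simps)

lemma cayley_nz [simp]: "cayley x \<noteq> 0"
  by (simp add: cayley_def)

lemma cnj_cayley: "cnj (cayley x) = 1 / cayley x"
  by (simp add: cayley_def)

lemma norm_cayley: "norm (cayley x) = 1"
proof -
  have "of_real x - \<i> = cnj (of_real x + \<i>)" by simp
  then have "norm (of_real x - \<i>) = norm (of_real x + \<i>)" by (metis complex_mod_cnj)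
  then show ?thesis by (simp add: cayley_def norm_divide)
qed

lemma one_minus_cayley: "1 - cayley x = 2 * \<i> / (of_real x + \<i>)"
  and one_plus_cayley: "1 + cayley x = 2 * of_real x / (of_real x + \<i>)"
  by (simp_all add: cayley_def divide_simps)

lemma cayley_neq_1: "cayley x \<noteq> 1"
  using one_minus_cayley[of x] by auto

lemma cayley_inverse: "\<i> * (1 + cayley x) / (1 - cayley x) = of_real x"
  by (simp add: one_minus_cayley one_plus_cayley)

lemma infinite_range_cayley: "infinite (range cayley)"
proof -
  have "inj cayley"
    by (rule injI) (metis cayley_inverse of_real_eq_iff)
  then show ?thesis using finite_imageD infinite_UNIV_char_0 by blast
qed

text \<open>Both conclusions are closed conditions on the angle, so they spread from almost every
  point of an open interval to all of it. Excluding \<open>z = 1\<close> keeps the angle inside; the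
  Cayley transform never takes that value.\<close>

lemma laurent_mat_psd_on_circle:
  fixes C :: "int \<Rightarrow> complex^'m^'m"
  assumes AE: "AE t in lebesgue_on {0..2 * pi}. positive_definite (laurent_mat N C (cis t))"
    and z: "norm z = 1" "z \<noteq> 1"
  shows "conj_transpose (laurent_mat N C z) = laurent_mat N C z"
    and "0 \<le> Re (herm_form (laurent_mat N C z) v)"
proof -
  let ?I = "{0<..<2 * pi}"
  have ae: "AE t\<in>?I in lebesgue. positive_definite (laurent_mat N C (cis t))"
    using AE by (subst (asm) AE_restrict_space_iff) auto
  have z_cis: "z = cis (Arg2pi z)"
    using z(1) Arg2pi_eq[of z] by (simp add: cis_conv_exp)
  have arg: "Arg2pi z \<in> ?I"
  proof -
    have "Arg2pi z \<noteq> 0" using z_cis z(2) by (metis cis_zero)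
    then show ?thesis using Arg2pi_ge_0[of z] Arg2pi_lt_2pi[of z] by simp
  qed
  have cont: "continuous_on UNIV (\<lambda>t. laurent_mat N C (cis t) $ i $ j)" for i j
    unfolding laurent_mat_nth by (intro continuous_intros) auto
  have "cnj (laurent_mat N C (cis t) $ j $ i) = laurent_mat N C (cis t) $ i $ j" if "t \<in> ?I" for t i j
  proof -
    have "t \<in> {t. cnj (laurent_mat N C (cis t) $ j $ i) = laurent_mat N C (cis t) $ i $ j}"
    proof (rule mem_closed_if_AE_lebesgue_open[OF _ _ _ that])
      show "closed {t. cnj (laurent_mat N C (cis t) $ j $ i) = laurent_mat N C (cis t) $ i $ j}"
        by (intro closed_Collect_eq continuous_intros cont)
      show "AE t\<in>?I in lebesgue. t \<in> {t. cnj (laurent_mat N C (cis t) $ j $ i) = laurent_mat N C (cis t) $ i $ j}"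
        using ae by eventually_elim (metis (mono_tags) conj_transpose_nth mem_Collect_eq positive_definite_def)
    qed simp
    then show ?thesis by simp
  qed
  then show "conj_transpose (laurent_mat N C z) = laurent_mat N C z"
    using arg by (subst (1 2) z_cis) (simp add: vec_eq_iff)
  have nonneg: "0 \<le> Re (herm_form A v)" if "positive_definite A" for A :: "complex^'m^'m"
    using that by (cases "v = 0") (auto simp: positive_definite_def herm_form_def less_imp_le)
  have "0 \<le> Re (herm_form (laurent_mat N C (cis t)) v)" if "t \<in> ?I" for t
  proof -
    have "t \<in> {t. 0 \<le> Re (herm_form (laurent_mat N C (cis t)) v)}"
    proof (rule mem_closed_if_AE_lebesgue_open[OF _ _ _ that])
      show "closed {t. 0 \<le> Re (herm_form (laurent_mat N C (cis t)) v)}"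
        unfolding herm_form_eq by (intro closed_Collect_le continuous_intros cont)
      show "AE t\<in>?I in lebesgue. t \<in> {t. 0 \<le> Re (herm_form (laurent_mat N C (cis t)) v)}"
        using ae by eventually_elim (simp add: nonneg)
    qed simp
    then show ?thesis by simp
  qed
  then show "0 \<le> Re (herm_form (laurent_mat N C z) v)"
    using arg by (subst z_cis) simp
qed

text \<open>Multiplying the entries by \<open>z ^ N\<close> bounds the degree of the determinant by
  \<open>2 * (N * CARD('m))\<close>. For \<open>L\<close> larger by \<open>k\<close>, the shift to
  \<open>laurent_poly L c\<close> raises this by only \<open>k\<close>, whereas \<open>2 * L\<close>
  exceeds it by \<open>2 * k\<close>.\<close>

lemma degree_det_laurent_mat_le:
  fixes C :: "int \<Rightarrow> complex^'m^'m"
  assumes c: "c (int L) \<noteq> 0"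
    and det: "\<And>z. z \<noteq> 0 \<Longrightarrow> det (laurent_mat N C z) = (\<Sum>n=-int L..int L. c n * z powi n)"
  shows "L \<le> N * CARD('m)"
proof (rule ccontr)
  assume "\<not> L \<le> N * CARD('m)"
  then obtain k where L: "L = N * CARD('m) + k" "k > 0" by (metis less_imp_add_positive not_le)
  define S :: "complex poly^'m^'m" where "S = (\<chi> i j. laurent_poly N (\<lambda>n. C n $ i $ j))"
  have deg: "degree (S $ i $ j) \<le> 2 * N" for i j by (simp add: S_def degree_laurent_poly)
  have "degree (\<Prod>i\<in>UNIV. S $ i $ p i) \<le> 2 * (N * CARD('m))" for p
    using degree_prod_le_sum[of UNIV "\<lambda>i. S $ i $ p i" "\<lambda>_. 2 * N"] deg by (simp add: mult_ac)
  then have "degree (det S) \<le> 2 * (N * CARD('m))"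
    unfolding det_def by (intro degree_sum_le order.trans[OF degree_mult_le]) (auto simp: finite_permutations)
  then have small: "degree (monom 1 k * det S) < 2 * L"
    using degree_mult_le[of "monom (1::complex) k" "det S"] degree_monom_le[of "1::complex" k] L by linarith
  have "laurent_poly L c = monom 1 k * det S"
  proof (rule poly_eq_on_infinite[of "UNIV - {0}"])
    fix z :: complex assume "z \<in> UNIV - {0}"
    then have z: "z \<noteq> 0" by simp
    have "eval_mat S z = mat_cscale (z ^ N) (laurent_mat N C z)"
      using z by (simp add: vec_eq_iff S_def poly_laurent_poly laurent_mat_nth)
    then have "poly (det S) z = z ^ (N * CARD('m)) * det (laurent_mat N C z)"
      by (simp add: poly_det det_mat_cscale power_mult)
    then show "poly (laurent_poly L c) z = poly (monom 1 k * det S) z"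
      using z by (simp add: poly_laurent_poly det poly_monom L(1) power_add)
  qed (simp add: infinite_UNIV_char_0)
  then have "coeff (laurent_poly L c) (2 * L) = 0" using small by (simp add: coeff_eq_0)
  then show False using c by (simp add: coeff_laurent_poly)
qed

text \<open>On the real line the diagonal entry is a sum of squared moduli and hence dominates each
  of them.\<close>

lemma degree_row_le:
  fixes Q :: "complex poly^'n^'m"
  assumes "degree ((Q ** adj_poly_mat Q) $ i $ i) \<le> 2 * N"
  shows "degree (Q $ i $ j) \<le> N"
proof -
  have "degree (Q $ i $ j * Q $ i $ j) \<le> degree ((Q ** adj_poly_mat Q) $ i $ i)"
  proof (rule degree_le_if_norm_le)
    fix x
    have "poly ((Q ** adj_poly_mat Q) $ i $ i) (of_real x) = of_real (\<Sum>k\<in>UNIV. (norm (poly (Q $ i $ k) (of_real x)))\<^sup>2)"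
      by (simp add: matrix_mult_nth poly_sum flip: complex_norm_square)
    then have "norm (poly ((Q ** adj_poly_mat Q) $ i $ i) (of_real x)) = (\<Sum>k\<in>UNIV. (norm (poly (Q $ i $ k) (of_real x)))\<^sup>2)"
      by (simp add: sum_nonneg del: of_real_sum)
    moreover have "(norm (poly (Q $ i $ j) (of_real x)))\<^sup>2 \<le> (\<Sum>k\<in>UNIV. (norm (poly (Q $ i $ k) (of_real x)))\<^sup>2)"
      by (rule member_le_sum) auto
    ultimately show "norm (poly (Q $ i $ j * Q $ i $ j) (of_real x)) \<le> norm (poly ((Q ** adj_poly_mat Q) $ i $ i) (of_real x))"
      by (simp add: norm_mult power2_eq_square)
  qed
  then show ?thesis using assms by (cases "Q $ i $ j = 0") (auto simp: degree_mult_eq)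
qed

section \<open>Construction of the spectral factor\<close>

theorem theorem2:
  fixes C :: "int \<Rightarrow> complex^'m^'m"
    and N L :: nat
    and p :: "complex poly"
  assumes "C (int N) \<noteq> 0"
    and "AE t in lebesgue_on {0..2 * pi}. positive_definite (laurent_mat N C (cis t))"
    and "laurent_poly_of_degree (\<lambda>z. det (laurent_mat N C z)) L"
    and "degree p \<le> L"
    and "\<And>z. z \<noteq> 0 \<Longrightarrow> poly p z * adj_fun (poly p) z = det (laurent_mat N C z)"
  shows "\<exists>B :: nat \<Rightarrow> complex^'m^'m.
           B N \<noteq> 0 \<and>
           (\<forall>z. z \<noteq> 0 \<longrightarrow>
              poly_mat N B z ** adj_mat_fun (poly_mat N B) z = laurent_mat N C z) \<and>
           (\<forall>z. det (poly_mat N B z) = poly p z)"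
proof -
  let ?S = "laurent_mat N C"
  let ?M = "N * CARD('m)"
  obtain c where c: "c (int L) \<noteq> 0" "\<And>z. z \<noteq> 0 \<Longrightarrow> det (?S z) = (\<Sum>n=-int L..int L. c n * z powi n)"
    using assms(3) unfolding laurent_poly_of_degree_def by metis
  \<comment> \<open>Allows \<open>p\<close> to be homogenized in degree \<open>?M\<close>.\<close>
  have deg_p: "degree p \<le> ?M"
    using degree_det_laurent_mat_le[OF c] assms(4) by linarith
  have p_nz: "p \<noteq> 0"
  proof
    assume "p = 0"
    have "laurent_poly L c = 0"
      by (rule poly_eq_on_infinite[of "UNIV - {0}"])
        (use \<open>p = 0\<close> assms(5) in \<open>auto simp: poly_laurent_poly c(2)[symmetric] infinite_UNIV_char_0\<close>)
    then have "coeff (laurent_poly L c) (2 * L) = 0" by simp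
    then show False using c(1) by (simp add: coeff_laurent_poly)
  qed
  have det_S: "det (?S (cayley x)) = poly p (cayley x) * cnj (poly p (cayley x))" for x
    using assms(5)[of "cayley x"] by (simp add: adj_fun_def cnj_cayley)

  define s where "s i j = laurent_poly N (\<lambda>n. C n $ i $ j)" for i j
  have s: "poly (s i j) z = z ^ N * ?S z $ i $ j" if "z \<noteq> 0" for i j z
    using that by (simp add: s_def poly_laurent_poly laurent_mat_nth)
  \<comment> \<open>The positive factor relating \<open>R\<close> to \<open>?S\<close>; it arises as
    \<open>(x + \<i>) ^ (2 * N)\<close>, clearing denominators, times the \<open>z ^ N\<close>
    contained in \<open>s\<close>.\<close>
  define \<rho> where "\<rho> x = (x\<^sup>2 + 1) ^ N" for x :: real
  have \<rho>_pos: "0 < \<rho> x" for x unfolding \<rho>_def by (intro zero_less_power add_nonneg_pos) auto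
  have \<rho>: "of_real (\<rho> x) = (of_real x + \<i>) ^ N * (of_real x - \<i>) ^ N" for x
    unfolding \<rho>_def of_real_power plus_i_times_minus_i[symmetric] power_mult_distrib ..
  define R :: "complex poly^'m^'m" where
    "R = (\<chi> i j. poly_homogenize (2 * N) [:- \<i>, 1:] [:\<i>, 1:] (s i j))"
  have cay: "poly (poly_homogenize n [:- \<i>, 1:] [:\<i>, 1:] f) (of_real x) = (of_real x + \<i>) ^ n * poly f (cayley x)"
    if "degree f \<le> n" for f n x
    using that by (subst poly_poly_homogenize) (auto simp: cayley_def add.commute)
  have R: "eval_mat R (of_real x) = mat_cscale (of_real (\<rho> x)) (?S (cayley x))" for x
  proof -
    have "(of_real x + \<i>) ^ (2 * N) * cayley x ^ N = of_real (\<rho> x)"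
      unfolding \<rho> cayley_def mult_2 power_add by (simp add: power_divide)
    then show ?thesis
      by (simp add: vec_eq_iff R_def cay s_def degree_laurent_poly)
        (simp add: s flip: s_def mult.assoc)
  qed
  \<comment> \<open>Degree \<open>?M\<close>, rather than the degree of \<open>p\<close>, makes
    \<open>q * cnj_poly q\<close> carry the factor \<open>\<rho> x ^ CARD('m)\<close> that
    \<open>det R\<close> has.\<close>
  define q where "q = poly_homogenize ?M [:- \<i>, 1:] [:\<i>, 1:] p"
  have q: "poly q (of_real x) = (of_real x + \<i>) ^ ?M * poly p (cayley x)" for x
    unfolding q_def using deg_p by (rule cay)
  have "q \<noteq> 0"
  proof
    assume "q = 0"
    then have "poly p (cayley x) = 0" for x using q[of x] by simp
    then have "p = 0" by (intro poly_eq_on_infinite[OF infinite_range_cayley]) auto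
    then show False using p_nz by simp
  qed
  have det_R: "det R = q * cnj_poly q"
  proof (rule poly_eq_on_reals)
    fix x
    have "poly (det R) (of_real x) = of_real (\<rho> x) ^ CARD('m) * det (?S (cayley x))"
      by (simp add: poly_det R det_mat_cscale)
    also have "\<dots> = poly (q * cnj_poly q) (of_real x)"
      unfolding \<rho> det_S by (simp add: q power_mult_distrib power_mult)
    finally show "poly (det R) (of_real x) = poly (q * cnj_poly q) (of_real x)" .
  qed
  have "pos_on_line R"
    unfolding pos_on_line_def
  proof (intro conjI allI)
    show "det R \<noteq> 0" using \<open>q \<noteq> 0\<close> det_R by simp
    note psd = laurent_mat_psd_on_circle[OF assms(2) norm_cayley cayley_neq_1]
    show "adj_poly_mat R = R"
    proof (rule poly_mat_eq_on_reals)
      fix x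
      have "cnj (?S (cayley x) $ j $ i) = ?S (cayley x) $ i $ j" for i j
        using psd(1) by (metis conj_transpose_nth)
      then show "eval_mat (adj_poly_mat R) (of_real x) = eval_mat R (of_real x)"
        by (simp add: eval_mat_adj R vec_eq_iff)
    qed
    show "0 \<le> Re (herm_form (eval_mat R (of_real x)) v)" for x v
      using psd(2) \<rho>_pos[of x] by (simp add: R herm_form_mat_cscale less_imp_le)
  qed
  then have "factorizes R q" using det_R by (rule factorizes_pos_on_line)
  then obtain Q where Q: "R = Q ** adj_poly_mat Q" "det Q = q" by (auto simp: factorizes_def)
  have deg_Q: "degree (Q $ i $ j) \<le> N" for i j
    by (rule degree_row_le) (simp add: Q(1)[symmetric] R_def degree_poly_homogenize)

  \<comment> \<open>Substitutes the inverse transform \<open>x = \<i> * (1 + z) / (1 - z)\<close>.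
    As \<open>1 - z = 2 * \<i> / (x + \<i>)\<close>, the constant in front leaves exactly
    \<open>Q(x) / (x + \<i>) ^ N\<close>.\<close>
  define P :: "complex poly^'m^'m" where
    "P = (\<chi> i j. smult (1 / (2 * \<i>) ^ N) (poly_homogenize N [:\<i>, \<i>:] [:1, -1:] (Q $ i $ j)))"
  have deg_P: "degree (P $ i $ j) \<le> N" for i j
    unfolding P_def by (simp add: degree_poly_homogenize)
  have P: "poly (P $ i $ j) (cayley x) = poly (Q $ i $ j) (of_real x) / (of_real x + \<i>) ^ N" for i j x
  proof -
    have "poly (poly_homogenize N [:\<i>, \<i>:] [:1, -1:] (Q $ i $ j)) (cayley x) =
       (1 - cayley x) ^ N * poly (Q $ i $ j) (\<i> * (1 + cayley x) / (1 - cayley x))"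
      using deg_Q cayley_neq_1[of x]
      by (subst poly_poly_homogenize) (auto simp: algebra_simps)
    then show ?thesis
      unfolding cayley_inverse by (simp add: P_def one_minus_cayley power_divide)
  qed
  define B where "B n = (\<chi> i j. coeff (P $ i $ j) n)" for n
  have B: "poly_mat N B z = eval_mat P z" for z
  proof -
    have "(\<Sum>n=0..N. coeff (P $ i $ j) n * z ^ n) = poly (P $ i $ j) z" for i j
      unfolding poly_altdef using deg_P[of i j]
      by (intro sum.mono_neutral_right) (auto simp: coeff_eq_0)
    then show ?thesis by (simp add: vec_eq_iff poly_mat_nth B_def)
  qed
  \<comment> \<open>The \<open>CARD('m)\<close> rows divided by \<open>(x + \<i>) ^ N\<close> remove
    precisely the power \<open>(x + \<i>) ^ ?M\<close> in \<open>q\<close>.\<close>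
  have "det P = p"
  proof (rule poly_eq_on_infinite[OF infinite_range_cayley])
    fix z assume "z \<in> range cayley"
    then obtain x where z: "z = cayley x" by auto
    have "eval_mat P z = mat_cscale (1 / (of_real x + \<i>) ^ N) (eval_mat Q (of_real x))"
      by (simp add: vec_eq_iff P z)
    then have "poly (det P) z = (1 / (of_real x + \<i>) ^ N) ^ CARD('m) * poly q (of_real x)"
      using Q(2) by (simp add: poly_det det_mat_cscale flip: Q(2))
    then show "poly (det P) z = poly p z" by (simp add: q z power_divide power_mult)
  qed

  \<comment> \<open>\<open>rev f\<close> is \<open>z\<^sup>N\<close> times the adjoint of \<open>f\<close>.\<close>
  define rev where "rev f = poly_homogenize N 1 [:0, 1:] (cnj_poly f)" for f
  have rev: "poly (rev f) z = z ^ N * cnj (poly f (1 / cnj z))" if "degree f \<le> N" "z \<noteq> 0" for f z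
    using that unfolding rev_def by (subst poly_poly_homogenize) auto
  have deg_rev: "degree (rev f) \<le> N" for f
    unfolding rev_def by (intro degree_poly_homogenize) auto
  \<comment> \<open>\<open>z ^ N\<close> times the product of \<open>P\<close> and its adjoint:
    being polynomial, it can be compared with \<open>s\<close> on the circle alone, and the identity
    then extends to all nonzero \<open>z\<close>.\<close>
  define F where "F i j = (\<Sum>k\<in>UNIV. P $ i $ k * rev (P $ j $ k))" for i j
  have F: "poly (F i j) z = z ^ N * (eval_mat P z ** adj_mat_fun (eval_mat P) z) $ i $ j" if "z \<noteq> 0" for i j z
    using that deg_P by (simp add: F_def poly_sum rev matrix_mult_nth adj_mat_fun_def sum_distrib_left mult_ac)
  have F_eq: "F i j = s i j" for i j
  proof (rule poly_eq_on_infinite[OF infinite_range_cayley])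
    fix z assume "z \<in> range cayley"
    then obtain x where z: "z = cayley x" by auto
    have "poly (F i j) z = z ^ N * (\<Sum>k\<in>UNIV. poly (P $ i $ k) z * cnj (poly (P $ j $ k) z))"
      by (simp add: F z matrix_mult_nth adj_mat_fun_def cnj_cayley)
    also have "\<dots> = z ^ N * ((\<Sum>k\<in>UNIV. poly (Q $ i $ k) (of_real x) * cnj (poly (Q $ j $ k) (of_real x))) / of_real (\<rho> x))"
      by (simp add: z P \<rho> sum_divide_distrib)
    also have "(\<Sum>k\<in>UNIV. poly (Q $ i $ k) (of_real x) * cnj (poly (Q $ j $ k) (of_real x))) = eval_mat R (of_real x) $ i $ j"
      by (simp add: Q(1) matrix_mult_nth poly_sum)
    also have "z ^ N * (eval_mat R (of_real x) $ i $ j / of_real (\<rho> x)) = poly (s i j) z"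
      using \<rho>_pos[of x] by (simp add: R s z)
    finally show "poly (F i j) z = poly (s i j) z" .
  qed
  \<comment> \<open>The coefficient of \<open>F i j\<close> at \<open>2 * N\<close> is the
    \<open>i\<close>, \<open>j\<close> entry of \<open>C (int N)\<close>, and each of its summands
    contains an entry of \<open>B N\<close>.\<close>
  have "B N \<noteq> 0"
  proof
    assume "B N = 0"
    then have "coeff (P $ i $ j) N = 0" for i j by (simp add: B_def vec_eq_iff)
    then have "coeff (F i j) (N + N) = 0" for i j
      by (simp add: F_def coeff_sum coeff_mult_top deg_P deg_rev)
    then have "C (int N) $ i $ j = 0" for i j
      unfolding F_eq s_def by (simp add: coeff_laurent_poly)
    then show False using assms(1) by (simp add: vec_eq_iff)
  qed
  moreover have "poly_mat N B z ** adj_mat_fun (poly_mat N B) z = ?S z" if z: "z \<noteq> 0" for z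
  proof -
    have "poly_mat N B = eval_mat P" by (simp add: fun_eq_iff B)
    moreover have "(eval_mat P z ** adj_mat_fun (eval_mat P) z) $ i $ j = ?S z $ i $ j" for i j
      using F[OF z, of i j] s[OF z, of i j] z by (simp add: F_eq)
    ultimately show ?thesis by (simp add: vec_eq_iff)
  qed
  moreover have "det (poly_mat N B z) = poly p z" for z
    using \<open>det P = p\<close> by (simp add: B flip: poly_det)
  ultimately show ?thesis by blast
qed

end
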